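(* If $A$ is a nonzero prime evolution algebra over a field $K$, then $\mathcal C(A)\cong K$ as $K$-algebras.
   Context: Algebras are not assumed associative. An evolution algebra over $K$ is a $K$-algebra $A$ having a basis $B=\{e_i\}_{i\in\Lambda}$ (a natural basis) with $e_ie_j=0$ for all $i\ne j$. $A$ is prime if for any ideals $I,J$ of $A$ with $IJ=0$ one has $I=0$ or $J=0$. The centroid $\mathcal C(A)$ of a $K$-algebra $A$ is the set of all $K$-linear maps $T:A\to A$ with $T(xy)=xT(y)=T(x)y$ for all $x,y\in A$; it is a $K$-algebra under addition and composition. *)

theory Defs
  imports Complex_Main "HOL-Algebra.QuotRing" "HOL-Algebra.Module"
begin

text \<open>
  A (not necessarily associative, not necessarily unital) algebra over a field is a vector space,
  carried by a whole type, with a bilinear product. No dimension restriction is imposed.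
\<close>

locale nonassoc_algebra = vector_space scale
  for scale :: "'k::field \<Rightarrow> 'a::ab_group_add \<Rightarrow> 'a" (infixr \<open>*s\<close> 75) +
  fixes times :: "'a \<Rightarrow> 'a \<Rightarrow> 'a" (infixl \<open>\<star>\<close> 70)
  assumes times_add_left: "(x + y) \<star> z = x \<star> z + y \<star> z"
    and times_add_right: "x \<star> (y + z) = x \<star> y + x \<star> z"
    and times_scale_left: "(c *s x) \<star> y = c *s (x \<star> y)"
    and times_scale_right: "x \<star> (c *s y) = c *s (x \<star> y)"
begin

definition natural_basis :: "'a set \<Rightarrow> bool" where
  "natural_basis B \<longleftrightarrow>
     independent B \<and> span B = UNIV \<and> (\<forall>e\<in>B. \<forall>f\<in>B. e \<noteq> f \<longrightarrow> e \<star> f = 0)"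

definition two_sided_ideal :: "'a set \<Rightarrow> bool" where
  "two_sided_ideal I \<longleftrightarrow> subspace I \<and> (\<forall>x\<in>I. \<forall>a. a \<star> x \<in> I \<and> x \<star> a \<in> I)"

definition ideal_prod :: "'a set \<Rightarrow> 'a set \<Rightarrow> 'a set" where
  "ideal_prod I J = span {x \<star> y |x y. x \<in> I \<and> y \<in> J}"

text \<open>The zero algebra satisfies this condition; nonzeroness is a separate hypothesis.\<close>

definition prime_algebra :: bool where
  "prime_algebra \<longleftrightarrow>
     (\<forall>I J. two_sided_ideal I \<longrightarrow> two_sided_ideal J \<longrightarrow> ideal_prod I J = {0} \<longrightarrow>
        I = {0} \<or> J = {0})"

definition centroid :: "('a \<Rightarrow> 'a) set" where
  "centroid = {T. Vector_Spaces.linear scale scale T \<and>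
     (\<forall>x y. T (x \<star> y) = x \<star> T y \<and> T (x \<star> y) = T x \<star> y)}"

definition centroid_algebra :: "('k, 'a \<Rightarrow> 'a) module" where
  "centroid_algebra =
     \<lparr>carrier = centroid, monoid.mult = (\<circ>), one = id,
      zero = (\<lambda>x. 0), add = (\<lambda>S T x. S x + T x), smult = (\<lambda>c T x. c *s T x)\<rparr>"

end

locale evolution_algebra = nonassoc_algebra +
  assumes ex_natural_basis: "\<exists>B. natural_basis B"

definition field_algebra :: "('k::field, 'k) module" where
  "field_algebra =
     \<lparr>carrier = UNIV, monoid.mult = (*), one = 1, zero = 0, add = (+), smult = (*)\<rparr>"

text \<open>
  Isomorphism of unital associative algebras over the field that is the whole scalar type.
  The library's \<open>algebra\<close> locale is not used because it demands commutativity.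
\<close>

definition algebra_isomorphic ::
  "('k::field, 'a, 'm) module_scheme \<Rightarrow> ('k, 'b, 'n) module_scheme \<Rightarrow> bool" where
  "algebra_isomorphic A B \<longleftrightarrow>
     (\<exists>h \<in> ring_iso A B. \<forall>c. \<forall>x \<in> carrier A. h (c \<odot>\<^bsub>A\<^esub> x) = c \<odot>\<^bsub>B\<^esub> h x)"

context nonassoc_algebra
begin

lemma centroid_iff:
  "T \<in> centroid \<longleftrightarrow>
     (\<forall>x y. T (x + y) = T x + T y) \<and> (\<forall>c x. T (c *s x) = c *s T x) \<and>
     (\<forall>x y. T (x \<star> y) = x \<star> T y) \<and> (\<forall>x y. T (x \<star> y) = T x \<star> y)"
  unfolding centroid_def Vector_Spaces.linear_iff using vector_space_axioms by auto

lemma times_zero [simp]: "0 \<star> x = 0" "x \<star> 0 = 0"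
  using times_scale_left[of 0 0 x] times_scale_right[of x 0 0] by simp_all

lemma times_uminus [simp]: "(- x) \<star> y = - (x \<star> y)" "x \<star> (- y) = - (x \<star> y)"
  using times_scale_left[of "-1" x y] times_scale_right[of x "-1" y] by simp_all

lemma comp_centroid: "S \<in> centroid \<Longrightarrow> T \<in> centroid \<Longrightarrow> S \<circ> T \<in> centroid"
  unfolding centroid_iff comp_def by metis

lemma ring_centroid_algebra: "ring centroid_algebra"
proof (intro ringI abelian_groupI monoidI)
  fix T assume T: "T \<in> carrier centroid_algebra"
  then have "(\<lambda>x. - T x) \<in> centroid"
    by (auto simp: centroid_algebra_def centroid_iff)
  then show "\<exists>S \<in> carrier centroid_algebra. S \<oplus>\<^bsub>centroid_algebra\<^esub> T = \<zero>\<^bsub>centroid_algebra\<^esub>"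
    by (intro bexI[of _ "\<lambda>x. - T x"]) (auto simp: centroid_algebra_def)
next
  fix S T assume "S \<in> carrier centroid_algebra" "T \<in> carrier centroid_algebra"
  then show "S \<otimes>\<^bsub>centroid_algebra\<^esub> T \<in> carrier centroid_algebra"
    by (simp add: centroid_algebra_def comp_centroid)
qed (auto simp: centroid_algebra_def centroid_iff algebra_simps fun_eq_iff
      times_add_left times_add_right times_scale_left times_scale_right)

lemma module_centroid_algebra: "Module.module field_algebra centroid_algebra"
proof (rule Module.module.intro)
  show "cring (field_algebra :: ('k, 'k) module)"
    by unfold_locales (auto simp: field_algebra_def Units_def algebra_simps
        intro: exI[of _ "- x" for x] add.left_inverse add.right_inverse)
  show "abelian_group centroid_algebra"
    using ring_centroid_algebra by (rule ring.is_abelian_group)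
  show "Module.module_axioms field_algebra centroid_algebra"
    by unfold_locales (auto simp: field_algebra_def centroid_algebra_def centroid_iff
        algebra_simps fun_eq_iff times_scale_left times_scale_right)
qed

lemma smult_centroid_algebra:
  assumes "S \<in> carrier centroid_algebra" "T \<in> carrier centroid_algebra"
  shows "(c \<odot>\<^bsub>centroid_algebra\<^esub> S) \<otimes>\<^bsub>centroid_algebra\<^esub> T =
           c \<odot>\<^bsub>centroid_algebra\<^esub> (S \<otimes>\<^bsub>centroid_algebra\<^esub> T)"
    and "S \<otimes>\<^bsub>centroid_algebra\<^esub> (c \<odot>\<^bsub>centroid_algebra\<^esub> T) =
           c \<odot>\<^bsub>centroid_algebra\<^esub> (S \<otimes>\<^bsub>centroid_algebra\<^esub> T)"
  using assms by (auto simp: centroid_algebra_def centroid_iff fun_eq_iff)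

end

end

theory Submission
  imports Defs
begin

text \<open>
  The argument has two halves. In a prime algebra the centroid behaves as in Schur's lemma: if
  \<open>S\<close> lies in the centroid, then its kernel and its range are ideals, and
  \<open>S x \<star> y = x \<star> S y\<close> shows that they multiply to zero, so primeness makes \<open>S\<close>
  either zero or injective. Applied to \<open>S = T - c\<close>, this says that a centroid element \<open>T\<close> with a single
  eigenvector is a scalar (\<open>centroid_eigenvector_imp_scalar\<close>).

  The natural basis supplies the eigenvector. If \<open>e\<close> and \<open>f\<close> are distinct basis vectors, then
  \<open>T e \<star> f = T (e \<star> f) = 0\<close>. Hence, once its \<open>e\<close>-component \<open>c *s e\<close> is removed, \<open>T e\<close>
  annihilates every basis vector. A prime algebra has no nonzero annihilator, as the annihilator
  is an ideal of square zero, so \<open>T e = c *s e\<close> (\<open>centroid_natural_basis_eigenvector\<close>).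
\<close>

context nonassoc_algebra
begin

lemma prime_algebra_zero_product:
  assumes "prime_algebra" "two_sided_ideal I" "two_sided_ideal J"
    and zero: "\<And>x y. x \<in> I \<Longrightarrow> y \<in> J \<Longrightarrow> x \<star> y = 0"
  shows "I = {0} \<or> J = {0}"
proof -
  have "{x \<star> y |x y. x \<in> I \<and> y \<in> J} \<subseteq> {0}"
    using zero by auto
  then have "ideal_prod I J \<subseteq> span {0}"
    unfolding ideal_prod_def by (rule span_mono)
  then have "ideal_prod I J = {0}"
    using span_zero unfolding ideal_prod_def by auto
  with assms show ?thesis
    unfolding prime_algebra_def by blast
qed

text \<open>The elements that annihilate the algebra on both sides form an ideal of square zero.\<close>

lemma prime_algebra_annihilator_zero:
  assumes "prime_algebra" and "\<And>y. d \<star> y = 0" and "\<And>y. y \<star> d = 0"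
  shows "d = 0"
proof -
  let ?N = "{x. \<forall>y. x \<star> y = 0 \<and> y \<star> x = 0}"
  have ideal: "two_sided_ideal ?N"
    unfolding two_sided_ideal_def
    by (auto intro!: subspaceI
        simp: times_add_left times_add_right times_scale_left times_scale_right)
  have "?N = {0} \<or> ?N = {0}"
    by (rule prime_algebra_zero_product[OF assms(1) ideal ideal]) simp
  moreover have "d \<in> ?N"
    using assms(2,3) by simp
  ultimately show ?thesis by simp
qed

lemma times_diff_left: "(x - y) \<star> z = x \<star> z - y \<star> z"
  using times_add_left[of x "- y" z] by simp

lemma times_diff_right: "x \<star> (y - z) = x \<star> y - x \<star> z"
  using times_add_right[of x y "- z"] by simp

lemma centroid_minus_scalar:
  assumes "T \<in> centroid"
  shows "(\<lambda>x. T x - c *s x) \<in> centroid"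
  using assms unfolding centroid_iff
  by (auto simp: times_diff_left times_diff_right times_scale_left times_scale_right
      scale_right_distrib scale_right_diff_distrib scale_left_commute)

lemma centroid_kernel_ideal:
  assumes "S \<in> centroid"
  shows "two_sided_ideal {x. S x = 0}"
proof -
  have "S 0 = S (0 *s 0)" by simp
  also have "\<dots> = 0" using assms unfolding centroid_iff by (metis scale_zero_left)
  finally have S0: "S 0 = 0" .
  have "S (a \<star> x) = 0 \<and> S (x \<star> a) = 0" if "S x = 0" for a x
    using assms that unfolding centroid_iff by (metis times_zero)
  then show ?thesis
    using assms S0 unfolding two_sided_ideal_def centroid_iff by (auto intro!: subspaceI)
qed

lemma centroid_range_ideal:
  assumes "S \<in> centroid"
  shows "two_sided_ideal (range S)"
proof -
  have S: "S x + S y = S (x + y)" "c *s S x = S (c *s x)" "a \<star> S x = S (a \<star> x)"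
    "S x \<star> a = S (x \<star> a)" for c a x y
    using assms unfolding centroid_iff by metis+
  have "S 0 = 0"
    using centroid_kernel_ideal[OF assms] by (simp add: two_sided_ideal_def subspace_def)
  then have "0 \<in> range S"
    by (metis rangeI)
  then have "subspace (range S)"
    by (intro subspaceI) (auto simp: S)
  then show ?thesis
    unfolding two_sided_ideal_def by (auto simp: S)
qed

text \<open>The range and the kernel of \<open>S\<close> are ideals with product zero, so one of them vanishes.\<close>

lemma centroid_injective_or_zero:
  assumes "prime_algebra" and S: "S \<in> centroid"
  shows "{x. S x = 0} = {0} \<or> (\<forall>x. S x = 0)"
proof -
  have "x \<star> y = 0" if xy: "x \<in> range S" "y \<in> {x. S x = 0}" for x y
  proof -
    obtain z where z: "x = S z" using xy by blast
    have "S z \<star> y = z \<star> S y"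
      using S unfolding centroid_iff by metis
    then show ?thesis using z xy by simp
  qed
  then have "range S = {0} \<or> {x. S x = 0} = {0}"
    by (rule prime_algebra_zero_product[OF assms(1) centroid_range_ideal[OF S]
          centroid_kernel_ideal[OF S]])
  then show ?thesis by blast
qed

text \<open>The eigenvector lies in the kernel of \<open>T - c\<close>, which is therefore not injective.\<close>

lemma centroid_eigenvector_imp_scalar:
  assumes "prime_algebra" "T \<in> centroid" "e \<noteq> 0" "T e = c *s e"
  shows "T = (\<lambda>x. c *s x)"
proof -
  have "\<forall>x. T x - c *s x = 0"
    using centroid_injective_or_zero[OF assms(1) centroid_minus_scalar[OF assms(2), of c]]
      assms(3,4) by auto
  then show ?thesis by (auto simp: fun_eq_iff)
qed

text \<open>
  The difference \<open>d\<close> of \<open>T e\<close> and its \<open>e\<close>-component kills the other basis vectors because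
  \<open>T e\<close> and \<open>e\<close> do, and it kills \<open>e\<close> because it lies in the span of the others.
  So \<open>d\<close> is an annihilator.
\<close>

lemma centroid_natural_basis_eigenvector:
  assumes prime: "prime_algebra" and B: "natural_basis B" and T: "T \<in> centroid" and e: "e \<in> B"
  shows "\<exists>c. T e = c *s e"
proof -
  have spanB: "span B = UNIV"
    and orth: "\<And>e f. e \<in> B \<Longrightarrow> f \<in> B \<Longrightarrow> e \<noteq> f \<Longrightarrow> e \<star> f = 0"
    using B unfolding natural_basis_def by auto
  obtain c where c: "T e - c *s e \<in> span (B - {e})"
    using span_breakdown[OF e, of "T e"] spanB by auto
  define d where "d = T e - c *s e"
  have T_mult: "T x \<star> y = T (x \<star> y)" "y \<star> T x = T (y \<star> x)" "T 0 = 0" for x y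
    using centroid_kernel_ideal[OF T] T
    unfolding centroid_iff two_sided_ideal_def subspace_def by auto
  have "d \<star> e = 0 \<and> e \<star> d = 0"
    using c unfolding d_def[symmetric]
  proof (induction d rule: span_induct_alt)
    case (step a f y)
    then show ?case
      using orth e
      by (auto simp: times_add_left times_add_right times_scale_left times_scale_right)
  qed simp
  moreover have "d \<star> f = 0 \<and> f \<star> d = 0" if f: "f \<in> B" "f \<noteq> e" for f
  proof -
    have "e \<star> f = 0" "f \<star> e = 0" using orth e f by auto
    then show ?thesis
      by (simp add: d_def times_diff_left times_diff_right times_scale_left times_scale_right
          T_mult)
  qed
  ultimately have on_B: "d \<star> f = 0 \<and> f \<star> d = 0" if "f \<in> B" for f
    using that by (cases "f = e") simp_all
  have "d \<star> y = 0 \<and> y \<star> d = 0" for y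
  proof -
    have "y \<in> span B" using spanB by simp
    then show ?thesis
    proof (induction y rule: span_induct_alt)
      case (step a f y)
      then show ?case
        using on_B
        by (auto simp: times_add_left times_add_right times_scale_left times_scale_right)
    qed simp
  qed
  then have "d = 0"
    using prime_algebra_annihilator_zero[OF prime] by blast
  then show ?thesis unfolding d_def by auto
qed

lemma scalar_in_centroid: "(\<lambda>x. c *s x) \<in> centroid"
  unfolding centroid_iff
  by (simp add: scale_right_distrib scale_left_commute times_scale_left times_scale_right)

lemma centroid_algebra_isomorphic_field:
  assumes nonzero: "(e :: 'a) \<noteq> 0"
    and scalar: "\<And>T. T \<in> centroid \<Longrightarrow> \<exists>c. T = (\<lambda>x. c *s x)"
  shows "algebra_isomorphic centroid_algebra (field_algebra :: ('k, 'k) module)"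
proof -
  define h where "h T = (THE c. T = (\<lambda>x. c *s x))" for T
  \<comment> \<open>Evaluation at a nonzero vector recovers the scalar, so \<open>h\<close> is well defined.\<close>
  have h_scalar: "h (\<lambda>x. c *s x) = c" for c
    unfolding h_def
  proof (rule the_equality)
    fix c' assume "(\<lambda>x. c *s x) = (\<lambda>x. c' *s x)"
    then have "c *s e = c' *s e" by (rule fun_cong)
    then show "c' = c" using nonzero by simp
  qed simp
  have h_eq: "T x = h T *s x" if "T \<in> centroid" for T x
    using scalar[OF that] h_scalar by auto
  have h_eqI: "h T = c" if "\<And>x. T x = c *s x" for T c
    using that h_scalar[of c] by (metis ext)
  have "h \<in> ring_hom centroid_algebra field_algebra"
  proof (rule ring_hom_memI)
    fix S T assume "S \<in> carrier centroid_algebra" "T \<in> carrier centroid_algebra"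
    then have ST: "S \<in> centroid" "T \<in> centroid"
      by (simp_all add: centroid_algebra_def)
    have "h (S \<circ> T) = h S * h T"
      by (rule h_eqI) (simp add: h_eq[OF ST(1)] h_eq[OF ST(2)])
    then show "h (S \<otimes>\<^bsub>centroid_algebra\<^esub> T) = h S \<otimes>\<^bsub>field_algebra\<^esub> h T"
      by (simp add: centroid_algebra_def field_algebra_def)
    have "h (\<lambda>x. S x + T x) = h S + h T"
      by (rule h_eqI) (simp add: h_eq[OF ST(1)] h_eq[OF ST(2)] scale_left_distrib)
    then show "h (S \<oplus>\<^bsub>centroid_algebra\<^esub> T) = h S \<oplus>\<^bsub>field_algebra\<^esub> h T"
      by (simp add: centroid_algebra_def field_algebra_def)
  next
    have "h id = 1" by (rule h_eqI) simp
    then show "h \<one>\<^bsub>centroid_algebra\<^esub> = \<one>\<^bsub>field_algebra\<^esub>"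
      by (simp add: centroid_algebra_def field_algebra_def)
  qed (simp add: field_algebra_def)
  moreover have "bij_betw h (carrier centroid_algebra) (carrier (field_algebra :: ('k, 'k) module))"
    by (rule bij_betw_byWitness[where f' = "\<lambda>c x. c *s x"])
      (auto simp: centroid_algebra_def field_algebra_def h_scalar scalar_in_centroid
        h_eq[symmetric])
  moreover have "h (c \<odot>\<^bsub>centroid_algebra\<^esub> T) = c \<odot>\<^bsub>field_algebra\<^esub> h T"
    if "T \<in> carrier centroid_algebra" for c T
  proof -
    have T: "T \<in> centroid" using that by (simp add: centroid_algebra_def)
    have "h (\<lambda>x. c *s T x) = c * h T"
      by (rule h_eqI) (simp add: h_eq[OF T])
    then show ?thesis
      by (simp add: centroid_algebra_def field_algebra_def)
  qed
  ultimately show ?thesis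
    unfolding algebra_isomorphic_def ring_iso_def by blast
qed

end

theorem corollary4p8:
  fixes scale :: "'k::field \<Rightarrow> 'a::ab_group_add \<Rightarrow> 'a"
    and times :: "'a \<Rightarrow> 'a \<Rightarrow> 'a"
  assumes "evolution_algebra scale times"
    and "nonassoc_algebra.prime_algebra scale times"
    and "\<exists>x::'a. x \<noteq> 0"
  shows "algebra_isomorphic (nonassoc_algebra.centroid_algebra scale times)
           (field_algebra :: ('k, 'k) module)"
proof -
  interpret evolution_algebra scale times by fact
  obtain B where B: "natural_basis B" using ex_natural_basis by blast
  have "B \<noteq> {}"
    using B assms(3) unfolding natural_basis_def by (metis span_empty UNIV_I singletonD)
  then obtain e where e: "e \<in> B" by blast
  have e0: "e \<noteq> 0"
    using B e dependent_zero unfolding natural_basis_def by blast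
  have "\<exists>c. T = scale c" if T: "T \<in> centroid" for T
  proof -
    obtain c where "T e = scale c e"
      using centroid_natural_basis_eigenvector[OF assms(2) B T e] by blast
    then show ?thesis
      using centroid_eigenvector_imp_scalar[OF assms(2) T e0] by blast
  qed
  then show ?thesis
    by (intro centroid_algebra_isomorphic_field[OF e0]) auto
qed

end
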